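(* Let $H$ be a fixed (non-empty, finite) directed acyclic graph and let $T_n$ be the complete binary tree of height $m$ with $n=2^{m+1}-1$ vertices. Let $|A_0|=|A_0(H)|$ be the number of sink vertices of $H$ and $|A_1|=|A_1(H)|$ the number of ancestor vertices of $H$. Then, as $n\to\infty$, $$[H]_{T_n}=\Theta\big(n^{|A_0|}(\ln n)^{|A_1|}\big).$$
   Context: A digraph here is a simple graph with a direction on each edge; it is acyclic if it has no directed cycle. An acyclic digraph $H$ induces a partial order on its vertices: $v<u$ if there is a directed path from $v$ to $u$; then $u$ is called a descendant of $v$. The nodes of a rooted tree are ordered by $a<b$ if $a$ is a proper ancestor of $b$ (the root is an ancestor of all other nodes). Define $$[H]_{T_n}=\big|\{\iota:V(H)\to V(T_n)\ \text{injective such that } u<v \text{ in } H \text{ implies } \iota(u)<\iota(v)\text{ in }T_n\}\big|.$$ (Incomparable vertices of $H$ may be mapped to comparable nodes.) A sink is a vertex of out-degree zero; $A_0(H)$ is the set of sinks. $A_1(H)$ (the "ancestor" vertices) is the set of non-sink vertices having exactly one descendant that is a sink. The constants implied by $\Theta$ may depend on $H$. *)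

theory Defs
  imports
    "Graph_Theory.Pair_Digraph"
    "HOL-Library.FuncSet"
    "HOL-Library.Sublist"
    "HOL-Library.Landau_Symbols"
begin

text \<open>
  The order induced by an acyclic digraph \<open>G\<close> is \<open>v \<rightarrow>\<^sup>+\<^bsub>G\<^esub> u\<close>, the existence of a directed path with
  at least one arc. Opposite arcs are not excluded separately, since \<^term>\<open>acyclic (parcs G)\<close>
  rules them out.
\<close>

definition acyclic_digraph :: "'a pair_pre_digraph \<Rightarrow> bool" where
  "acyclic_digraph G \<longleftrightarrow> pair_digraph G \<and> acyclic (parcs G)"

definition sinks :: "'a pair_pre_digraph \<Rightarrow> 'a set" where
  "sinks G = {v \<in> pverts G. out_degree G v = 0}"

definition ancestor_verts :: "'a pair_pre_digraph \<Rightarrow> 'a set" where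
  "ancestor_verts G =
     {v \<in> pverts G. v \<notin> sinks G \<and> card {u \<in> sinks G. v \<rightarrow>\<^sup>+\<^bsub>G\<^esub> u} = 1}"

text \<open>
  A node of the complete binary tree is named by the left/right choices on the path from the root
  to it. Arcs point away from the root, so the induced order is the proper ancestor relation.
\<close>

definition complete_binary_tree :: "nat \<Rightarrow> bool list pair_pre_digraph" where
  "complete_binary_tree m =
     \<lparr> pverts = {w. length w \<le> m}, parcs = {(w, w @ [b]) | w b. length w < m} \<rparr>"

text \<open>
  \<open>[H]\<^sub>T\<close>. Maps are taken to be \<^term>\<open>undefined\<close> outside the vertices of \<open>H\<close>, so that each map
  \<open>V(H) \<rightarrow> V(T)\<close> is counted once. Incomparable vertices of \<open>H\<close> may be mapped to comparable ones.
\<close>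

definition order_preserving_injections ::
  "'a pair_pre_digraph \<Rightarrow> 'b pair_pre_digraph \<Rightarrow> ('a \<Rightarrow> 'b) set" where
  "order_preserving_injections H T =
     {\<iota> \<in> pverts H \<rightarrow>\<^sub>E pverts T. inj_on \<iota> (pverts H) \<and>
        (\<forall>u \<in> pverts H. \<forall>v \<in> pverts H. u \<rightarrow>\<^sup>+\<^bsub>H\<^esub> v \<longrightarrow> \<iota> u \<rightarrow>\<^sup>+\<^bsub>T\<^esub> \<iota> v)}"

definition embedding_count :: "'a pair_pre_digraph \<Rightarrow> 'b pair_pre_digraph \<Rightarrow> nat" where
  "embedding_count H T = card (order_preserving_injections H T)"

lemma acyclic_digraph_no_opposite_arcs:
  assumes "acyclic_digraph G" "(u, v) \<in> parcs G"
  shows "(v, u) \<notin> parcs G"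
  using assms unfolding acyclic_digraph_def acyclic_def
  by (meson r_into_trancl' trancl_into_trancl)

lemma card_complete_binary_tree: "card (pverts (complete_binary_tree m)) = 2 ^ (m + 1) - 1"
proof -
  have "card {w :: bool list. length w \<le> m} = (\<Sum>i\<le>m. 2 ^ i)"
    using card_lists_length_le[of "UNIV :: bool set" m] by simp
  also have "\<dots> = 2 ^ (m + 1) - 1"
    by (induction m) simp_all
  finally show ?thesis
    by (simp add: complete_binary_tree_def)
qed

lemma reachable1_complete_binary_tree:
  "v \<rightarrow>\<^sup>+\<^bsub>complete_binary_tree m\<^esub> w \<longleftrightarrow> strict_prefix v w \<and> length w \<le> m"
proof
  assume "v \<rightarrow>\<^sup>+\<^bsub>complete_binary_tree m\<^esub> w"
  then show "strict_prefix v w \<and> length w \<le> m"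
    by (induction rule: trancl_induct)
       (auto simp: complete_binary_tree_def strict_prefix_def)
next
  have "(v, v @ b # bs) \<in> (parcs (complete_binary_tree m))\<^sup>+"
    if "length (v @ b # bs) \<le> m" for b bs
    using that
  proof (induction bs rule: rev_induct)
    case Nil
    then show ?case by (auto simp: complete_binary_tree_def)
  next
    case (snoc x xs)
    have "(v @ b # xs, (v @ b # xs) @ [x]) \<in> parcs (complete_binary_tree m)"
      using snoc.prems unfolding complete_binary_tree_def by fastforce
    then show ?case
      using snoc by (auto intro: trancl_into_trancl)
  qed
  then show "strict_prefix v w \<and> length w \<le> m \<Longrightarrow> v \<rightarrow>\<^sup>+\<^bsub>complete_binary_tree m\<^esub> w"
    by (auto elim!: strict_prefixE')
qed

end

theory Submission
  imports Defs "HOL-Real_Asymp.Real_Asymp"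
begin

text \<open>
  Upper bound: fix the images of the sinks, \<open>n\<close> choices each. A vertex with one sink below it is then
  mapped to one of at most \<open>m + 1\<close> prefixes of the image of that sink. A vertex with two sinks below it
  (a \<^emph>\<open>branching\<close> vertex) is mapped to a common prefix of two images, and since only a fraction \<open>4\<^sup>-\<^sup>k\<close>
  of the pairs of nodes lies below a given node of depth \<open>k\<close>, of which there are \<open>2\<^sup>k\<close>, every moment of
  the number of common prefixes is bounded on average.

  Lower bound: number the \<open>h\<close> vertices of \<open>H\<close> topologically and give each sink its own code word of
  length \<open>2 h\<close>, all of them starting with the same \<open>h\<close> letters. Sinks are sent to arbitrary leaves below
  their code word, branching vertices to the common path of length \<open>h\<close>, and an ancestor vertex to the
  path towards its sink, at an arbitrary depth within one of \<open>h\<close> disjoint blocks of \<open>\<Theta>(m)\<close> levels,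
  chosen according to the numbering.
\<close>

section \<open>The order of an acyclic digraph\<close>

text \<open>Induction on \<open>A\<close>: take out an element with no successor inside
  \<open>A\<close> and give it the last number. The lower bound uses the numbers to keep vertices on
  distinct levels.\<close>

lemma finite_acyclic_topological_numbering:
  assumes "finite A" "acyclic r"
  obtains \<tau> :: "'a \<Rightarrow> nat"
  where "inj_on \<tau> A" "\<tau> ` A \<subseteq> {..<card A}" "\<And>u v. u \<in> A \<Longrightarrow> v \<in> A \<Longrightarrow> (u, v) \<in> r \<Longrightarrow> \<tau> u < \<tau> v"
proof -
  have "\<exists>\<tau> :: 'a \<Rightarrow> nat. inj_on \<tau> A \<and> \<tau> ` A \<subseteq> {..<card A} \<and>
      (\<forall>u\<in>A. \<forall>v\<in>A. (u, v) \<in> r \<longrightarrow> \<tau> u < \<tau> v)"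
    using assms(1)
  proof (induction rule: finite_psubset_induct)
    case (psubset A)
    show ?case
    proof (cases "A = {}")
      case True
      then show ?thesis by auto
    next
      case False
      \<comment> \<open>\<open>r\<close> itself may be infinite; cut down to \<open>A\<close> it is
        finite, so its converse is well-founded and a maximal element exists.\<close>
      have "acyclic (r \<inter> A \<times> A)"
        using assms(2) by (rule acyclic_subset) auto
      then have "wf ((r \<inter> A \<times> A)\<inverse>)"
        using psubset.hyps by (intro finite_acyclic_wf_converse) auto
      then obtain x where x: "x \<in> A" "\<And>y. y \<in> A \<Longrightarrow> (x, y) \<notin> r"
        using False unfolding wf_eq_minimal by (metis IntI SigmaI converse_iff ex_in_conv)
      obtain \<tau> :: "'a \<Rightarrow> nat" where \<tau>: "inj_on \<tau> (A - {x})" "\<tau> ` (A - {x}) \<subseteq> {..<card (A - {x})}"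
        "\<And>u v. u \<in> A - {x} \<Longrightarrow> v \<in> A - {x} \<Longrightarrow> (u, v) \<in> r \<Longrightarrow> \<tau> u < \<tau> v"
        using psubset.IH[of "A - {x}"] x(1) by blast
      have c: "card A = Suc (card (A - {x}))"
        using psubset.hyps x(1) by (rule card.remove)
      let ?\<tau> = "\<tau>(x := card (A - {x}))"
      have lt: "\<tau> u < card (A - {x})" if "u \<in> A" "u \<noteq> x" for u
        using \<tau>(2) that by auto
      have "inj_on ?\<tau> A"
        using \<tau>(1) lt by (fastforce simp: inj_on_def)
      moreover have "?\<tau> ` A \<subseteq> {..<card A}"
        using lt c by (auto simp: less_Suc_eq)
      moreover have "\<forall>u\<in>A. \<forall>v\<in>A. (u, v) \<in> r \<longrightarrow> ?\<tau> u < ?\<tau> v"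
        using \<tau>(3) lt x(2) by auto
      ultimately show ?thesis by blast
    qed
  qed
  then show ?thesis using that by blast
qed

section \<open>Sinks below a vertex, and the three kinds of vertices\<close>

text \<open>The reflexive closure puts a sink below itself, so that every vertex of \<open>H\<close>
  has a sink below it and sinks need no separate treatment.\<close>

definition sinks_below :: "'a pair_pre_digraph \<Rightarrow> 'a \<Rightarrow> 'a set" where
  "sinks_below G v = {s \<in> sinks G. (v, s) \<in> (parcs G)\<^sup>*}"

definition branching_verts :: "'a pair_pre_digraph \<Rightarrow> 'a set" where
  "branching_verts G = pverts G - sinks G - ancestor_verts G"

locale finite_dag =
  fixes H :: "'a pair_pre_digraph"
  assumes dag: "acyclic_digraph H"
begin

sublocale pair_digraph H
  using dag by (simp add: acyclic_digraph_def)

lemma acyclic_parcs: "acyclic (parcs H)"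
  using dag by (simp add: acyclic_digraph_def)

lemma sinks_eq: "sinks H = {v \<in> pverts H. \<forall>w. (v, w) \<notin> parcs H}"
  using pair_finite_arcs
  by (auto simp: sinks_def out_degree_def out_arcs_def card_eq_0_iff)

lemma trancl_in_verts: "(u, v) \<in> (parcs H)\<^sup>+ \<Longrightarrow> u \<in> pverts H \<and> v \<in> pverts H"
  by (metis in_arcsD1 in_arcsD2 tranclD tranclD2)

lemma sinks_below_mono: "(u, v) \<in> (parcs H)\<^sup>+ \<Longrightarrow> sinks_below H v \<subseteq> sinks_below H u"
  by (auto simp: sinks_below_def intro: rtrancl_trans[OF trancl_into_rtrancl])

lemma not_sink_if_trancl: "(u, v) \<in> (parcs H)\<^sup>+ \<Longrightarrow> u \<notin> sinks H"
  by (auto simp: sinks_eq dest: tranclD)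

lemma sinks_below_sink: "s \<in> sinks H \<Longrightarrow> sinks_below H s = {s}"
  using not_sink_if_trancl by (auto simp: sinks_below_def rtrancl_eq_or_trancl)

lemma finite_sinks: "finite (sinks H)"
  using pair_finite_verts by (simp add: sinks_eq)

lemma finite_sinks_below: "finite (sinks_below H v)"
  using finite_sinks by (simp add: sinks_below_def)

text \<open>Following arcs must stop in a finite acyclic digraph, and it can stop only at a
  sink.\<close>

lemma sinks_below_nonempty:
  assumes "v \<in> pverts H" shows "sinks_below H v \<noteq> {}"
proof -
  have "wf ((parcs H)\<inverse>)"
    using pair_finite_arcs acyclic_parcs by (rule finite_acyclic_wf_converse)
  then show ?thesis
    using assms
  proof (induction v rule: wf_induct_rule)
    case (less v)
    show ?case
    proof (cases "v \<in> sinks H")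
      case True
      then show ?thesis by (simp add: sinks_below_sink)
    next
      case False
      then obtain w where "(v, w) \<in> parcs H" using less.prems by (auto simp: sinks_eq)
      then show ?thesis
        using less.IH[of w] sinks_below_mono[of v w] in_arcsD2 by blast
    qed
  qed
qed

lemma card_sinks_below_pos: "v \<in> pverts H \<Longrightarrow> 0 < card (sinks_below H v)"
  using sinks_below_nonempty finite_sinks_below by (simp add: card_gt_0_iff)

lemma sinks_below_nonsink: "v \<notin> sinks H \<Longrightarrow> sinks_below H v = {s \<in> sinks H. (v, s) \<in> (parcs H)\<^sup>+}"
  by (auto simp: sinks_below_def rtrancl_eq_or_trancl)

lemma ancestor_verts_eq: "ancestor_verts H = {v \<in> pverts H - sinks H. card (sinks_below H v) = 1}"
  by (auto simp: ancestor_verts_def sinks_below_nonsink)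

lemma sinks_subset: "sinks H \<subseteq> pverts H"
  by (auto simp: sinks_eq)

lemma pverts_partition:
  "pverts H = sinks H \<union> (ancestor_verts H \<union> branching_verts H)"
  "sinks H \<inter> (ancestor_verts H \<union> branching_verts H) = {}"
  "ancestor_verts H \<inter> branching_verts H = {}"
  using sinks_subset by (auto simp: branching_verts_def ancestor_verts_eq)

lemma finite_parts: "finite (ancestor_verts H)" "finite (branching_verts H)"
  using pair_finite_verts by (auto simp: branching_verts_def ancestor_verts_eq)

lemma branching_verts_card:
  assumes "v \<in> branching_verts H" shows "2 \<le> card (sinks_below H v)"
  using assms card_sinks_below_pos[of v] by (auto simp: branching_verts_def ancestor_verts_eq)

lemma branching_verts_obtain:
  assumes "v \<in> branching_verts H"
  obtains s t where "s \<in> sinks_below H v" "t \<in> sinks_below H v" "s \<noteq> t"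
proof -
  have "sinks_below H v \<noteq> {}"
    using assms sinks_below_nonempty[of v] by (auto simp: branching_verts_def)
  then show ?thesis
    using branching_verts_card[OF assms] that finite_sinks_below
    by (metis card_le_Suc0_iff_eq not_less_eq_eq numeral_2_eq_2)
qed

text \<open>Going up only enlarges the set of sinks below. Hence no ancestor vertex lies above a
  branching one, which lets the lower bound put branching vertices on the topmost levels.\<close>

lemma branching_verts_upward:
  assumes "(u, v) \<in> (parcs H)\<^sup>+" "v \<in> branching_verts H" shows "u \<in> branching_verts H"
proof -
  have "card (sinks_below H u) \<ge> 2"
    using branching_verts_card[OF assms(2)] card_mono[OF finite_sinks_below sinks_below_mono[OF assms(1)]]
    by linarith
  then show ?thesis
    using not_sink_if_trancl[OF assms(1)] trancl_in_verts[OF assms(1)]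
    by (auto simp: branching_verts_def ancestor_verts_eq)
qed

text \<open>The depth bound in tree reachability is already implied by the codomain, and paths of
  \<open>H\<close> have both ends in \<open>H\<close>. Only the prefix condition remains.\<close>

lemma order_preserving_injections_tree:
  "order_preserving_injections H (complete_binary_tree m) =
    {\<iota> \<in> pverts H \<rightarrow>\<^sub>E {w. length w \<le> m}. inj_on \<iota> (pverts H) \<and>
      (\<forall>u v. (u, v) \<in> (parcs H)\<^sup>+ \<longrightarrow> strict_prefix (\<iota> u) (\<iota> v))}"
proof -
  have "(\<forall>u \<in> pverts H. \<forall>v \<in> pverts H. (u, v) \<in> (parcs H)\<^sup>+ \<longrightarrow>
      strict_prefix (\<iota> u) (\<iota> v) \<and> length (\<iota> v) \<le> m) \<longleftrightarrow>
    (\<forall>u v. (u, v) \<in> (parcs H)\<^sup>+ \<longrightarrow> strict_prefix (\<iota> u) (\<iota> v))"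
    if "\<iota> \<in> pverts H \<rightarrow>\<^sub>E {w. length w \<le> m}" for \<iota> :: "'a \<Rightarrow> bool list"
    using that trancl_in_verts by (auto simp: PiE_iff)
  moreover have "pverts (complete_binary_tree m) = {w. length w \<le> m}"
    by (simp add: complete_binary_tree_def)
  moreover have "(v, w) \<in> (parcs (complete_binary_tree m))\<^sup>+ \<longleftrightarrow> strict_prefix v w \<and> length w \<le> m" for v w
    using reachable1_complete_binary_tree[of v w m] by simp
  ultimately show ?thesis
    by (auto simp: order_preserving_injections_def)
qed

end

section \<open>Upper bound\<close>

lemma finite_bounded_bool_lists: "finite {w :: bool list. length w \<le> m}"
  using finite_lists_length_le[of "UNIV :: bool set" m] by simp

lemma card_bounded_bool_lists: "card {w :: bool list. length w \<le> m} = 2 ^ (m + 1) - 1"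
  using card_complete_binary_tree[of m] by (simp add: complete_binary_tree_def)

lemma card_bool_lists_length_eq: "card {w :: bool list. length w = k} = 2 ^ k"
  using card_lists_length_eq[of "UNIV :: bool set" k] by simp

text \<open>The nodes below \<open>w\<close> form a tree of height \<open>m - length w\<close>. If
  \<open>w\<close> is too long there are none, and the bound is 1.\<close>

lemma card_extensions_le:
  "card {p :: bool list. length p \<le> m \<and> prefix w p} \<le> 2 ^ (m + 1 - length w)"
proof (cases "length w \<le> m")
  case True
  have "{p :: bool list. length p \<le> m \<and> prefix w p} \<subseteq> (@) w ` {u. length u \<le> m - length w}"
    by (auto simp: prefix_def)
  then have "card {p :: bool list. length p \<le> m \<and> prefix w p} \<le> card {u :: bool list. length u \<le> m - length w}"
    by (rule surj_card_le[OF finite_bounded_bool_lists])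
  also have "\<dots> \<le> 2 ^ (m + 1 - length w)"
    using True by (simp add: card_bounded_bool_lists Suc_diff_le)
  finally show ?thesis .
next
  case False
  then have "{p :: bool list. length p \<le> m \<and> prefix w p} = {}"
    by (auto dest: prefix_length_le)
  then show ?thesis by (simp only: card.empty)
qed

lemma card_prefixes: "card {w. prefix w p} = Suc (length p)"
  using card_set_prefixes[of p] by (simp only: set_prefixes_eq)

section \<open>Common prefixes of two words and their moments\<close>

definition common_prefixes :: "'a list \<Rightarrow> 'a list \<Rightarrow> 'a list set" where
  "common_prefixes p q = {w. prefix w p \<and> prefix w q}"

lemma common_prefixes_eq: "common_prefixes p q = {w. prefix w (longest_common_prefix p q)}"
  by (auto simp: common_prefixes_def
      intro: longest_common_prefix_max_prefix prefix_order.trans[OF _ longest_common_prefix_prefix1]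
        prefix_order.trans[OF _ longest_common_prefix_prefix2])

lemma finite_common_prefixes: "finite (common_prefixes p q)"
  unfolding common_prefixes_eq by (simp flip: set_prefixes_eq)

lemma card_common_prefixes: "card (common_prefixes p q) = Suc (length (longest_common_prefix p q))"
  by (simp add: common_prefixes_eq card_prefixes)

lemma card_common_prefixes_power_le:
  "card (common_prefixes p q) ^ b \<le> (\<Sum>w\<in>common_prefixes p q. Suc (length w) ^ b)"
proof -
  \<comment> \<open>The summand of the longest common prefix alone is the left-hand side.\<close>
  have "longest_common_prefix p q \<in> common_prefixes p q"
    by (simp add: common_prefixes_eq)
  then show ?thesis
    unfolding card_common_prefixes by (intro member_le_sum) (auto simp: finite_common_prefixes)
qed

text \<open>Ratio test: quotients of consecutive numerators tend to 1, so they are eventually below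
  3/2, and the denominators halve this to 3/4.\<close>

lemma summable_power_div_two_power: "summable (\<lambda>k. real (Suc k) ^ b / 2 ^ k)"
proof -
  have "(\<lambda>k. real (Suc (Suc k)) / real (Suc k)) \<longlonglongrightarrow> 1"
    by real_asymp
  then have "(\<lambda>k. (real (Suc (Suc k)) / real (Suc k)) ^ b) \<longlonglongrightarrow> 1 ^ b"
    by (rule tendsto_power)
  then have "eventually (\<lambda>k. (real (Suc (Suc k)) / real (Suc k)) ^ b < 3/2) sequentially"
    by (rule order_tendstoD) simp
  then obtain N where N: "\<And>k. N \<le> k \<Longrightarrow> (real (Suc (Suc k)) / real (Suc k)) ^ b < 3/2"
    by (auto simp: eventually_sequentially)
  show ?thesis
  proof (rule summable_ratio_test[of "3/4" N])
    fix k assume "N \<le> k"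
    then have "real (Suc (Suc k)) ^ b \<le> 3/2 * real (Suc k) ^ b"
      using N[of k] by (simp add: power_divide divide_simps)
    then show "norm (real (Suc (Suc k)) ^ b / 2 ^ Suc k) \<le> 3/4 * norm (real (Suc k) ^ b / 2 ^ k)"
      by (simp add: divide_simps del: of_nat_Suc)
  qed simp
qed

text \<open>Group by depth \<open>k\<close>: there are \<open>2 ^ k\<close> words, each with a
  square equal to \<open>4 ^ (m + 1)\<close> divided by \<open>4 ^ k\<close>. What remains is a
  partial sum of a convergent series, whose full value is a \<open>K\<close> independent of
  \<open>m\<close>.\<close>

lemma sum_length_power_four_le:
  obtains K :: real where "0 \<le> K"
    "\<And>m. (\<Sum>w\<in>{w :: bool list. length w \<le> m}. real (Suc (length w)) ^ b * (2 ^ (m + 1 - length w))\<^sup>2)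
        \<le> K * 4 ^ (m + 1)"
proof
  let ?K = "\<Sum>k. real (Suc k) ^ b / 2 ^ k"
  show "0 \<le> ?K" by (rule suminf_nonneg[OF summable_power_div_two_power]) simp
  fix m
  let ?N = "{w :: bool list. length w \<le> m}"
  have "(\<Sum>w\<in>?N. real (Suc (length w)) ^ b * (2 ^ (m + 1 - length w))\<^sup>2)
      = (\<Sum>k\<le>m. \<Sum>w\<in>{w \<in> ?N. length w = k}. real (Suc (length w)) ^ b * (2 ^ (m + 1 - length w))\<^sup>2)"
    by (rule sum.group[symmetric]) (auto simp: finite_bounded_bool_lists)
  also have "\<dots> = (\<Sum>k\<le>m. 4 ^ (m + 1) * (real (Suc k) ^ b / 2 ^ k))"
  proof (rule sum.cong[OF refl])
    fix k assume k: "k \<in> {..m}"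
    have "(\<Sum>w\<in>{w \<in> ?N. length w = k}. real (Suc (length w)) ^ b * (2 ^ (m + 1 - length w))\<^sup>2)
        = (\<Sum>w\<in>{w :: bool list. length w = k}. real (Suc k) ^ b * (2 ^ (m + 1 - k))\<^sup>2)"
      using k by (intro sum.cong) auto
    also have "\<dots> = 2 ^ k * (real (Suc k) ^ b * (2 ^ (m + 1 - k))\<^sup>2)"
      by (simp add: card_bool_lists_length_eq)
    also have "\<dots> = 4 ^ (m + 1) * (real (Suc k) ^ b / 2 ^ k)"
    proof -
      have "(2 :: real) ^ (m + 1) = 2 ^ k * 2 ^ (m + 1 - k)"
        using k by (simp flip: power_add)
      moreover have "(4 :: real) ^ (m + 1) = (2 ^ (m + 1))\<^sup>2"
        by (simp add: power2_eq_square flip: power_mult_distrib)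
      ultimately have "(4 :: real) ^ (m + 1) = (2 ^ k * 2 ^ (m + 1 - k))\<^sup>2"
        by simp
      then show ?thesis by (simp add: power2_eq_square field_simps)
    qed
    finally show "(\<Sum>w\<in>{w \<in> ?N. length w = k}. real (Suc (length w)) ^ b * (2 ^ (m + 1 - length w))\<^sup>2)
        = 4 ^ (m + 1) * (real (Suc k) ^ b / 2 ^ k)" .
  qed
  also have "\<dots> = 4 ^ (m + 1) * (\<Sum>k\<le>m. real (Suc k) ^ b / 2 ^ k)"
    by (simp add: sum_distrib_left)
  also have "\<dots> \<le> 4 ^ (m + 1) * ?K"
    by (intro mult_left_mono sum_le_suminf summable_power_div_two_power) auto
  finally show "(\<Sum>w\<in>?N. real (Suc (length w)) ^ b * (2 ^ (m + 1 - length w))\<^sup>2) \<le> ?K * 4 ^ (m + 1)"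
    by (simp add: mult.commute)
qed

text \<open>Each power is at most a sum over common prefixes \<open>w\<close>, and the two sums are
  swapped. For fixed \<open>w\<close>, the coordinates \<open>s\<close> and \<open>t\<close> are
  confined to the subtree of \<open>w\<close>, while the other \<open>card A - 2\<close> stay
  free.\<close>

lemma sum_common_prefixes_power_le:
  fixes m :: nat
  assumes "finite A" "s \<in> A" "t \<in> A" "s \<noteq> t"
  defines "N \<equiv> {w :: bool list. length w \<le> m}"
  shows "(\<Sum>x \<in> A \<rightarrow>\<^sub>E N. card (common_prefixes (x s) (x t)) ^ b)
    \<le> (\<Sum>w\<in>N. Suc (length w) ^ b * (2 ^ (m + 1 - length w))\<^sup>2) * card N ^ (card A - 2)"
proof -
  have finN: "finite N" by (simp add: N_def finite_bounded_bool_lists)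
  then have finP: "finite (A \<rightarrow>\<^sub>E N)" using assms(1) by (intro finite_PiE) auto
  have sub: "common_prefixes (x s) (x t) \<subseteq> N" if "x \<in> A \<rightarrow>\<^sub>E N" for x
    using that assms(2) by (fastforce simp: common_prefixes_def N_def PiE_iff dest: prefix_length_le)
  have "(\<Sum>x \<in> A \<rightarrow>\<^sub>E N. card (common_prefixes (x s) (x t)) ^ b)
      \<le> (\<Sum>x \<in> A \<rightarrow>\<^sub>E N. \<Sum>w\<in>common_prefixes (x s) (x t). Suc (length w) ^ b)"
    by (intro sum_mono card_common_prefixes_power_le)
  also have "\<dots> = (\<Sum>x \<in> A \<rightarrow>\<^sub>E N. \<Sum>w\<in>{w \<in> N. w \<in> common_prefixes (x s) (x t)}. Suc (length w) ^ b)"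
    using sub by (intro sum.cong) auto
  also have "\<dots> = (\<Sum>w\<in>N. \<Sum>x\<in>{x \<in> A \<rightarrow>\<^sub>E N. w \<in> common_prefixes (x s) (x t)}. Suc (length w) ^ b)"
    by (rule sum.swap_restrict[OF finP finN])
  also have "\<dots> = (\<Sum>w\<in>N. Suc (length w) ^ b * card {x \<in> A \<rightarrow>\<^sub>E N. w \<in> common_prefixes (x s) (x t)})"
    by (simp add: mult.commute)
  also have "\<dots> \<le> (\<Sum>w\<in>N. Suc (length w) ^ b * ((2 ^ (m + 1 - length w))\<^sup>2 * card N ^ (card A - 2)))"
  proof (intro sum_mono mult_left_mono)
    fix w assume "w \<in> N"
    let ?F = "\<lambda>u. if u = s \<or> u = t then {p \<in> N. prefix w p} else N"
    have "(\<forall>u\<in>A. x u \<in> ?F u) \<longleftrightarrow> (\<forall>u\<in>A. x u \<in> N) \<and> prefix w (x s) \<and> prefix w (x t)" for x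
      using assms(2,3) by (smt (verit) mem_Collect_eq)
    then have "{x \<in> A \<rightarrow>\<^sub>E N. w \<in> common_prefixes (x s) (x t)} = PiE A ?F"
      unfolding PiE_iff set_eq_iff common_prefixes_def by blast
    then have "card {x \<in> A \<rightarrow>\<^sub>E N. w \<in> common_prefixes (x s) (x t)} = (\<Prod>u\<in>A. card (?F u))"
      using assms(1) by (simp add: card_PiE)
    also have "\<dots> = (\<Prod>u\<in>{s, t}. card (?F u)) * (\<Prod>u\<in>A - {s, t}. card (?F u))"
      using assms(1-3) by (subst mult.commute) (intro prod.subset_diff, auto)
    also have "(\<Prod>u\<in>{s, t}. card (?F u)) = (card {p \<in> N. prefix w p})\<^sup>2"
      using assms(4) by (simp add: power2_eq_square)
    also have "(\<Prod>u\<in>A - {s, t}. card (?F u)) = (\<Prod>u\<in>A - {s, t}. card N)"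
      by (intro prod.cong) auto
    also have "\<dots> = card N ^ (card A - 2)"
      using assms(1-4) by (simp add: card_Diff_subset numeral_2_eq_2)
    finally show "card {x \<in> A \<rightarrow>\<^sub>E N. w \<in> common_prefixes (x s) (x t)}
        \<le> (2 ^ (m + 1 - length w))\<^sup>2 * card N ^ (card A - 2)"
      using card_extensions_le[of m w] by (simp add: N_def power_mono)
  qed simp
  finally show ?thesis by (simp add: sum_distrib_right mult.assoc)
qed

text \<open>Every factor is at most the largest one; the 1 covers the empty product. This splits a
  product over branching vertices into terms that involve one pair of sinks each, so dependence
  between the pairs does no harm.\<close>

lemma prod_le_one_plus_sum_power:
  fixes f :: "'a \<Rightarrow> nat"
  assumes "finite B"
  shows "(\<Prod>v\<in>B. f v) \<le> 1 + (\<Sum>v\<in>B. f v ^ card B)"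
proof (cases "B = {}")
  case False
  then obtain v where v: "v \<in> B" "\<And>u. u \<in> B \<Longrightarrow> f u \<le> f v"
    using Max_in[of "f ` B"] Max_ge[of "f ` B"] assms by (metis (no_types, lifting) finite_imageI imageE imageI image_is_empty)
  have "(\<Prod>u\<in>B. f u) \<le> (\<Prod>u\<in>B. f v)" using v by (intro prod_mono) auto
  also have "\<dots> = f v ^ card B" by simp
  also have "\<dots> \<le> (\<Sum>v\<in>B. f v ^ card B)" using v assms by (intro member_le_sum) auto
  finally show ?thesis by simp
qed simp

section \<open>The upper bound for the embedding count\<close>

context finite_dag
begin

text \<open>Forgetting injectivity and all relations between vertices that are not sinks leaves
  independent choices for these vertices once the images \<open>x\<close> of the sinks are
  fixed.\<close>

lemma embedding_count_le:
  obtains C :: real where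
    "\<And>m. embedding_count H (complete_binary_tree m)
        \<le> C * real (2 ^ (m + 1) - 1) ^ card (sinks H) * real (Suc m) ^ card (ancestor_verts H)"
proof -
  let ?B = "branching_verts H" and ?C = "ancestor_verts H \<union> branching_verts H"
  let ?a = "card (sinks H)" and ?b = "card (branching_verts H)"
  \<comment> \<open>An ancestor vertex has a single sink below it, so \<open>s\<close> and
    \<open>t\<close> can be asked to differ only at branching vertices.\<close>
  have "\<forall>v\<in>?C. \<exists>s t. s \<in> sinks_below H v \<and> t \<in> sinks_below H v \<and> (v \<in> ?B \<longrightarrow> s \<noteq> t)"
  proof
    fix v assume v: "v \<in> ?C"
    then have "v \<in> pverts H" using pverts_partition(1) by blast
    then show "\<exists>s t. s \<in> sinks_below H v \<and> t \<in> sinks_below H v \<and> (v \<in> ?B \<longrightarrow> s \<noteq> t)"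
      using sinks_below_nonempty[of v] branching_verts_obtain[of v] by (metis equals0I)
  qed
  then obtain s t where st:
    "\<And>v. v \<in> ?C \<Longrightarrow> s v \<in> sinks_below H v" "\<And>v. v \<in> ?C \<Longrightarrow> t v \<in> sinks_below H v"
    "\<And>v. v \<in> ?B \<Longrightarrow> s v \<noteq> t v"
    by (metis UnI2)
  then have sinks_st: "s v \<in> sinks H" "t v \<in> sinks H" if "v \<in> ?C" for v
    using that by (auto simp: sinks_below_def)
  \<comment> \<open>The exponent is the number of branching vertices, as produced by
    \<open>prod_le_one_plus_sum_power\<close>.\<close>
  obtain K :: real where K: "0 \<le> K"
    "\<And>m. (\<Sum>w\<in>{w :: bool list. length w \<le> m}. real (Suc (length w)) ^ ?b * (2 ^ (m + 1 - length w))\<^sup>2)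
        \<le> K * 4 ^ (m + 1)"
    by (rule sum_length_power_four_le[where b = ?b]) blast
  \<comment> \<open>The 1 is the constant term of \<open>prod_le_one_plus_sum_power\<close>; each of
    the \<open>?b\<close> branching vertices adds \<open>4 * K\<close>.\<close>
  have "embedding_count H (complete_binary_tree m)
      \<le> (1 + ?b * (4 * K)) * real (2 ^ (m + 1) - 1) ^ ?a * real (Suc m) ^ card (ancestor_verts H)" for m
  proof -
    define N where "N = {w :: bool list. length w \<le> m}"
    let ?E = "order_preserving_injections H (complete_binary_tree m)"
    define F where "F x v = (if v \<in> ancestor_verts H then {w. prefix w (x (s v))}
      else common_prefixes (x (s v)) (x (t v)))" for x :: "'a \<Rightarrow> bool list" and v
    \<comment> \<open>The unnormalised moment of order \<open>?b\<close> of the number of common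
      prefixes, over all placements of the sinks.\<close>
    define S where "S v = (\<Sum>x\<in>sinks H \<rightarrow>\<^sub>E N. card (common_prefixes (x (s v)) (x (t v))) ^ ?b)" for v
    have finN: "finite N" by (simp add: N_def finite_bounded_bool_lists)
    have cardN: "card N = 2 ^ (m + 1) - 1" unfolding N_def by (rule card_bounded_bool_lists)
    have finP: "finite (sinks H \<rightarrow>\<^sub>E N)" using finN finite_sinks by (intro finite_PiE) auto
    have finC: "finite ?C" using finite_parts by simp
    have finF: "finite (F x v)" for x v
      by (auto simp: F_def finite_common_prefixes simp flip: set_prefixes_eq)
    let ?r = "\<lambda>\<iota> :: 'a \<Rightarrow> bool list. (restrict \<iota> (sinks H), restrict \<iota> ?C)"
    have "inj_on ?r ?E"
    proof (rule inj_onI)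
      fix \<iota> \<kappa> assume A: "\<iota> \<in> ?E" "\<kappa> \<in> ?E" "?r \<iota> = ?r \<kappa>"
      show "\<iota> = \<kappa>"
      proof (rule extensionalityI[of _ "pverts H"])
        show "\<iota> \<in> extensional (pverts H)" "\<kappa> \<in> extensional (pverts H)"
          using A by (auto simp: order_preserving_injections_tree PiE_iff)
        show "\<iota> v = \<kappa> v" if "v \<in> pverts H" for v
          using that A(3) unfolding pverts_partition(1) by (metis Un_iff prod.inject restrict_apply')
      qed
    qed
    moreover have "?r ` ?E \<subseteq> Sigma (sinks H \<rightarrow>\<^sub>E N) (\<lambda>x. PiE ?C (F x))"
    proof (intro subsetI, elim imageE)
      fix p \<iota> assume p: "p = ?r \<iota>" and \<iota>: "\<iota> \<in> ?E"
      have pre: "prefix (\<iota> v) (\<iota> (s v))" "prefix (\<iota> v) (\<iota> (t v))" if "v \<in> ?C" for v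
        using that \<iota> st(1,2)[of v] pverts_partition(2)
        by (auto simp: order_preserving_injections_tree sinks_below_def rtrancl_eq_or_trancl strict_prefix_def)
      have "restrict \<iota> (sinks H) \<in> sinks H \<rightarrow>\<^sub>E N"
        using \<iota> sinks_subset by (auto simp: order_preserving_injections_tree N_def PiE_iff)
      moreover have "restrict \<iota> ?C \<in> PiE ?C (F (restrict \<iota> (sinks H)))"
        using pre sinks_st by (auto simp: F_def common_prefixes_def)
      ultimately show "p \<in> Sigma (sinks H \<rightarrow>\<^sub>E N) (\<lambda>x. PiE ?C (F x))"
        by (simp add: p)
    qed
    ultimately have "card ?E \<le> card (Sigma (sinks H \<rightarrow>\<^sub>E N) (\<lambda>x. PiE ?C (F x)))"
      using finP finC finF by (intro card_inj_on_le[where f = ?r] finite_SigmaI finite_PiE[OF finC]) auto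
    also have "\<dots> = (\<Sum>x\<in>sinks H \<rightarrow>\<^sub>E N. \<Prod>v\<in>?C. card (F x v))"
      using finP finC finF by (simp add: card_SigmaI finite_PiE card_PiE)
    also have "\<dots> \<le> (\<Sum>x\<in>sinks H \<rightarrow>\<^sub>E N. Suc m ^ card (ancestor_verts H) *
        (1 + (\<Sum>v\<in>?B. card (common_prefixes (x (s v)) (x (t v))) ^ ?b)))"
    proof (rule sum_mono)
      fix x assume x: "x \<in> sinks H \<rightarrow>\<^sub>E N"
      have "(\<Prod>v\<in>?C. card (F x v)) = (\<Prod>v\<in>ancestor_verts H. card (F x v)) * (\<Prod>v\<in>?B. card (F x v))"
        using finite_parts pverts_partition(3) by (rule prod.union_disjoint)
      also have "(\<Prod>v\<in>ancestor_verts H. card (F x v)) \<le> (\<Prod>v\<in>ancestor_verts H. Suc m)"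
        using x sinks_st by (intro prod_mono) (auto simp: F_def card_prefixes N_def PiE_iff)
      also have "(\<Prod>v\<in>?B. card (F x v)) = (\<Prod>v\<in>?B. card (common_prefixes (x (s v)) (x (t v))))"
        using pverts_partition(3) by (intro prod.cong) (auto simp: F_def)
      also have "\<dots> \<le> 1 + (\<Sum>v\<in>?B. card (common_prefixes (x (s v)) (x (t v))) ^ ?b)"
        using finite_parts(2) by (rule prod_le_one_plus_sum_power)
      finally show "(\<Prod>v\<in>?C. card (F x v)) \<le> Suc m ^ card (ancestor_verts H) *
        (1 + (\<Sum>v\<in>?B. card (common_prefixes (x (s v)) (x (t v))) ^ ?b))"
        by simp
    qed
    also have "\<dots> = Suc m ^ card (ancestor_verts H) * (card N ^ ?a + (\<Sum>v\<in>?B. S v))"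
    proof -
      have "(\<Sum>v\<in>?B. S v) = (\<Sum>x\<in>sinks H \<rightarrow>\<^sub>E N. \<Sum>v\<in>?B. card (common_prefixes (x (s v)) (x (t v))) ^ ?b)"
        unfolding S_def by (rule sum.swap)
      moreover have "card N ^ ?a = card (sinks H \<rightarrow>\<^sub>E N)"
        using finite_sinks by (simp add: card_PiE)
      ultimately show ?thesis by (simp only: sum_distrib_left[symmetric] sum.distrib card_eq_sum)
    qed
    finally have "card ?E \<le> Suc m ^ card (ancestor_verts H) * (card N ^ ?a + (\<Sum>v\<in>?B. S v))" .
    then have "real (card ?E) \<le> real (Suc m ^ card (ancestor_verts H) * (card N ^ ?a + (\<Sum>v\<in>?B. S v)))"
      by (rule of_nat_mono)
    also have "\<dots> = real (Suc m) ^ card (ancestor_verts H) * (real (card N) ^ ?a + (\<Sum>v\<in>?B. real (S v)))"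
      by (simp only: of_nat_mult of_nat_add of_nat_power of_nat_sum)
    also have "\<dots> \<le> real (Suc m) ^ card (ancestor_verts H) * (real (card N) ^ ?a +
        (\<Sum>v\<in>?B. 4 * K * real (card N) ^ ?a))"
    proof (intro mult_left_mono add_left_mono sum_mono)
      fix v assume v: "v \<in> ?B"
      have sv: "s v \<in> sinks H" "t v \<in> sinks H" "s v \<noteq> t v"
        using v sinks_st st(3) by auto
      \<comment> \<open>Two distinct sinks give \<open>?a\<close> at least 2, so the subtraction in
        \<open>?a - 2\<close> does not truncate.\<close>
      then have "card {s v, t v} \<le> ?a" using finite_sinks by (intro card_mono) auto
      then have a: "?a = 2 + (?a - 2)" using sv(3) by simp
      have "real (S v) \<le> real ((\<Sum>w\<in>N. Suc (length w) ^ ?b * (2 ^ (m + 1 - length w))\<^sup>2) * card N ^ (?a - 2))"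
        unfolding N_def S_def by (intro of_nat_mono sum_common_prefixes_power_le finite_sinks sv)
      also have "\<dots> = (\<Sum>w\<in>N. real (Suc (length w)) ^ ?b * (2 ^ (m + 1 - length w))\<^sup>2) * real (card N) ^ (?a - 2)"
        by simp
      also have "\<dots> \<le> K * 4 ^ (m + 1) * real (card N) ^ (?a - 2)"
        using K(2)[of m] by (intro mult_right_mono) (auto simp: N_def)
      also have "\<dots> \<le> K * (4 * real (card N) ^ 2) * real (card N) ^ (?a - 2)"
      proof -
        \<comment> \<open>The factor 4 pays for replacing \<open>2 ^ (m + 1)\<close> by the slightly
          smaller \<open>card N\<close>.\<close>
        have "(2 :: real) ^ m \<le> real (card N)" by (simp add: cardN of_nat_diff)
        then have "((2 :: real) ^ m)\<^sup>2 \<le> real (card N) ^ 2" by (intro power_mono) auto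
        moreover have "(4 :: real) ^ (m + 1) = 4 * (2 ^ m)\<^sup>2"
          by (simp add: power2_eq_square flip: power_mult_distrib)
        ultimately show ?thesis using K(1) by (intro mult_right_mono mult_left_mono) auto
      qed
      also have "\<dots> = 4 * K * real (card N) ^ ?a"
        by (subst (2) a) (simp only: power_add mult_ac)
      finally show "real (S v) \<le> 4 * K * real (card N) ^ ?a" .
    qed simp
    also have "\<dots> = (1 + ?b * (4 * K)) * real (card N) ^ ?a * real (Suc m) ^ card (ancestor_verts H)"
      by (simp add: algebra_simps)
    finally show ?thesis
      unfolding embedding_count_def cardN .
  qed
  then show ?thesis by (rule that[of "1 + real ?b * (4 * K)"])
qed

end

section \<open>Lower bound\<close>

context finite_dag
begin

text \<open>The left-hand side counts pairs \<open>(U, j)\<close>: \<open>U\<close> gives the last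
  \<open>m - 2 * h\<close> letters for each sink, \<open>j\<close> the level of each ancestor vertex
  inside its block. Each pair yields an embedding from which it can be recovered.\<close>

lemma embedding_count_ge:
  assumes m: "2 * card (pverts H) \<le> m"
  defines "h \<equiv> card (pverts H)"
  shows "(2 ^ (m - 2 * h)) ^ card (sinks H) * ((m - 2 * h) div h) ^ card (ancestor_verts H)
    \<le> embedding_count H (complete_binary_tree m)"
proof -
  let ?A0 = "sinks H" and ?A1 = "ancestor_verts H" and ?B = "branching_verts H"
  have m': "2 * h \<le> m" using m by (simp add: h_def)
  \<comment> \<open>The block size: \<open>h\<close> blocks of \<open>q\<close> levels fit between
    depth \<open>2 * h\<close> and depth \<open>m\<close>, the leaves excluded.\<close>
  define q where "q = (m - 2 * h) div h"
  obtain \<tau> :: "'a \<Rightarrow> nat" where \<tau>: "inj_on \<tau> (pverts H)" "\<tau> ` pverts H \<subseteq> {..<h}"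
    "\<And>u v. u \<in> pverts H \<Longrightarrow> v \<in> pverts H \<Longrightarrow> (u, v) \<in> (parcs H)\<^sup>+ \<Longrightarrow> \<tau> u < \<tau> v"
    using finite_acyclic_topological_numbering[OF pair_finite_verts, of "(parcs H)\<^sup>+"] acyclic_parcs
    unfolding h_def acyclic_def by (metis trancl_trans_induct trancl_id trans_trancl)
  have \<tau>_less: "\<tau> v < h" if "v \<in> pverts H" for v using \<tau>(2) that by auto
  \<comment> \<open>The first \<open>h\<close> letters are shared by all sinks; the number of
    \<open>True\<close> letters afterwards identifies the sink, and the padding makes all lengths
    \<open>2 * h\<close>.\<close>
  define code where "code s = replicate h False @ replicate (\<tau> s) True @ replicate (h - \<tau> s) False" for s
  define X where "X U s = code s @ U s" for U :: "'a \<Rightarrow> bool list" and s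
  \<comment> \<open>The depth of each image: branching vertices stay within the shared letters,
    ancestor vertices come after the code word, and sinks are leaves.\<close>
  define l where "l j v = (if v \<in> ?A0 then m else if v \<in> ?A1 then 2 * h + \<tau> v * q + j v else \<tau> v)"
    for j :: "'a \<Rightarrow> nat" and v
  \<comment> \<open>The choice of the sink is immaterial: a branching vertex only takes shared
    letters, and any other vertex has just one sink below it.\<close>
  define \<Phi> where "\<Phi> = (\<lambda>(U, j). \<lambda>v\<in>pverts H. take (l j v) (X U (SOME s. s \<in> sinks_below H v)))"
  let ?P = "(?A0 \<rightarrow>\<^sub>E {u :: bool list. length u = m - 2 * h}) \<times> (?A1 \<rightarrow>\<^sub>E {..<q})"
  have length_code: "length (code s) = 2 * h" if "s \<in> pverts H" for s
    using \<tau>_less[OF that] by (simp add: code_def)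
  have code_inj: "s = t" if "s \<in> pverts H" "t \<in> pverts H" "code s = code t" for s t
  proof -
    have "length (filter id (code s)) = \<tau> s" for s by (simp add: code_def)
    then have "\<tau> s = \<tau> t" using that(3) by metis
    then show ?thesis using \<tau>(1) that by (simp add: inj_on_eq_iff)
  qed
  have l_A1: "2 * h \<le> l j v" "l j v < 2 * h + Suc (\<tau> v) * q" "l j v < m"
    if "v \<in> ?A1" "j \<in> ?A1 \<rightarrow>\<^sub>E {..<q}" for j v
  proof -
    have v: "v \<in> pverts H" "v \<notin> ?A0" using that(1) by (auto simp: ancestor_verts_eq)
    have j: "j v < q" using that by auto
    have "Suc (\<tau> v) * q \<le> h * q" using \<tau>_less[OF v(1)] by (intro mult_right_mono) auto
    also have "\<dots> \<le> m - 2 * h" by (simp add: q_def)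
    finally show "2 * h \<le> l j v" "l j v < 2 * h + Suc (\<tau> v) * q" "l j v < m"
      using v that(1) j m' by (auto simp: l_def)
  qed
  have l_A1_mono: "l j u < l j v"
    if "u \<in> ?A1" "v \<in> ?A1" "j \<in> ?A1 \<rightarrow>\<^sub>E {..<q}" "\<tau> u < \<tau> v" for j u v
  proof -
    have "Suc (\<tau> u) * q \<le> \<tau> v * q" using that(4) by (intro mult_right_mono) auto
    moreover have "2 * h + \<tau> v * q \<le> l j v" using that(2) by (auto simp: l_def ancestor_verts_eq)
    ultimately show ?thesis using l_A1(2)[OF that(1,3)] by linarith
  qed
  have l_le: "l j v \<le> m" if "v \<in> pverts H" "j \<in> ?A1 \<rightarrow>\<^sub>E {..<q}" for j v
    using l_A1(3)[OF _ that(2), of v] \<tau>_less[OF that(1)] m' by (auto simp: l_def)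
  have l_B: "l j v = \<tau> v" if "v \<in> ?B" for j v
    using that by (simp add: l_def branching_verts_def)
  have l_mono: "l j u < l j v" if uv: "(u, v) \<in> (parcs H)\<^sup>+" and j: "j \<in> ?A1 \<rightarrow>\<^sub>E {..<q}" for j u v
  proof -
    have V: "u \<in> pverts H" "v \<in> pverts H" using trancl_in_verts[OF uv] by auto
    have lt: "\<tau> u < \<tau> v" using \<tau>(3) V uv by blast
    have u0: "u \<notin> ?A0" using not_sink_if_trancl[OF uv] .
    \<comment> \<open>In the first case \<open>u\<close> is branching too, by
      \<open>branching_verts_upward\<close>, so both depths are values of \<tau>.\<close>
    consider "v \<in> ?B" | "u \<in> ?A1" "v \<in> ?A1" | "u \<in> ?B" "v \<notin> ?B" | "u \<in> ?A1" "v \<in> ?A0"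
      using V u0 branching_verts_upward[OF uv] pverts_partition(1) by blast
    then show ?thesis
    proof cases
      case 1
      then show ?thesis using branching_verts_upward[OF uv] l_B lt by simp
    next
      case 2
      then show ?thesis using l_A1_mono j lt by blast
    next
      case 3
      then have "h \<le> l j v"
        using l_A1(1)[OF _ j, of v] V pverts_partition(1) m' by (auto simp: l_def)
      then show ?thesis using 3 l_B \<tau>_less[OF V(1)] by simp
    next
      case 4
      then show ?thesis using l_A1(3)[OF 4(1) j] by (simp add: l_def)
    qed
  qed
  have \<Phi>_eq: "\<Phi> (U, j) v = take (l j v) (X U s)" if v: "v \<in> pverts H" and s: "s \<in> sinks_below H v" for U j v s
  proof -
    define t where "t = (SOME s. s \<in> sinks_below H v)"
    have t: "t \<in> sinks_below H v" unfolding t_def using s by (rule someI)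
    have "take (l j v) (X U t) = take (l j v) (X U s)"
    proof (cases "v \<in> ?B")
      case True
      then show ?thesis using \<tau>_less[OF v] by (simp add: l_B X_def code_def)
    next
      case False
      then have "v \<in> ?A0 \<or> v \<in> ?A1" using v pverts_partition(1) by blast
      then have "card (sinks_below H v) = 1"
        by (auto simp: ancestor_verts_eq sinks_below_sink)
      then show ?thesis using s t by (metis card_1_singletonE singletonD)
    qed
    then show ?thesis using v by (simp only: \<Phi>_def t_def prod.case restrict_apply')
  qed
  have lX: "length (X U s) = m" if "s \<in> ?A0" "U \<in> ?A0 \<rightarrow>\<^sub>E {u. length u = m - 2 * h}" for U s
  proof -
    have "length (U s) = m - 2 * h" using that by (auto dest: PiE_mem)
    moreover have "length (code s) = 2 * h" using that(1) sinks_subset length_code by blast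
    ultimately show ?thesis using m' by (simp add: X_def)
  qed
  have l\<Phi>: "length (\<Phi> (U, j) v) = l j v" if v: "v \<in> pverts H" and P: "(U, j) \<in> ?P" for U j v
  proof -
    obtain s where s: "s \<in> sinks_below H v" using sinks_below_nonempty[OF v] by blast
    then have "length (X U s) = m" using P lX by (auto simp: sinks_below_def)
    then show ?thesis using \<Phi>_eq[OF v s] l_le[OF v] P by auto
  qed
  have "\<Phi> ` ?P \<subseteq> order_preserving_injections H (complete_binary_tree m)"
  proof (intro subsetI, elim imageE)
    fix \<iota> p assume "\<iota> = \<Phi> p" and "p \<in> ?P"
    moreover obtain U j where "p = (U, j)" by fastforce
    ultimately have \<iota>: "\<iota> = \<Phi> (U, j)" and P: "(U, j) \<in> ?P" by auto
    then have j: "j \<in> ?A1 \<rightarrow>\<^sub>E {..<q}" by auto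
    have "\<iota> \<in> pverts H \<rightarrow>\<^sub>E {w. length w \<le> m}"
      using l\<Phi>[OF _ P] l_le[OF _ j] by (auto simp: \<iota> PiE_iff) (simp add: \<Phi>_def)
    moreover have "inj_on \<iota> (pverts H)"
    proof (rule inj_onI)
      fix u v assume u: "u \<in> pverts H" and v: "v \<in> pverts H" and eq: "\<iota> u = \<iota> v"
      then have leq: "l j u = l j v" using l\<Phi>[OF _ P] \<iota> by metis
      \<comment> \<open>Branching images have depth less than \<open>h\<close>, so equal depths
        never mix a branching vertex with another one.\<close>
      have big: "2 * h \<le> l j v" if "v \<in> pverts H" "v \<notin> ?B" for v
        using that l_A1(1)[OF _ j, of v] pverts_partition(1) m' by (auto simp: l_def)
      show "u = v"
      proof (cases "u \<in> ?B \<or> v \<in> ?B")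
        case True
        then have "u \<in> ?B" "v \<in> ?B" using leq big u v \<tau>_less l_B
          by (metis (no_types, lifting) leD le_add1 mult_2 order.trans)+
        then show ?thesis using leq l_B \<tau>(1) u v by (simp add: inj_on_eq_iff)
      next
        case False
        obtain s t where s: "s \<in> sinks_below H u" and t: "t \<in> sinks_below H v"
          using sinks_below_nonempty u v by blast
        then have st: "s \<in> ?A0" "t \<in> ?A0" by (auto simp: sinks_below_def)
        \<comment> \<open>Both images are long enough to contain a whole code word, which reveals
          the sink.\<close>
        have "take (2 * h) (\<Phi> (U, j) u) = code s"
          using big[of u] False u length_code[of s] st sinks_subset
          by (auto simp: \<Phi>_eq[OF u s] X_def min_def)
        moreover have "take (2 * h) (\<Phi> (U, j) v) = code t"
          using big[of v] False v length_code[of t] st sinks_subset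
          by (auto simp: \<Phi>_eq[OF v t] X_def min_def)
        ultimately have "s = t"
          using eq st sinks_subset by (intro code_inj) (auto simp: \<iota>)
        consider "u \<in> ?A0" "v \<in> ?A0" | "u \<in> ?A1" "v \<in> ?A0" | "u \<in> ?A0" "v \<in> ?A1" | "u \<in> ?A1" "v \<in> ?A1"
          using False u v pverts_partition(1) by blast
        then show ?thesis
        proof cases
          case 1
          then show ?thesis using s t \<open>s = t\<close> by (simp add: sinks_below_sink)
        next
          case 2
          then show ?thesis using leq l_A1(3)[OF _ j, of u] by (simp add: l_def)
        next
          case 3
          then show ?thesis using leq l_A1(3)[OF _ j, of v] by (simp add: l_def)
        next
          case 4
          \<comment> \<open>Blocks belonging to different numbers are disjoint.\<close>
          then have "\<tau> u = \<tau> v"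
            using leq l_A1_mono[OF 4 j] l_A1_mono[OF 4(2,1) j] by (metis less_irrefl linorder_cases)
          then show ?thesis using \<tau>(1) u v by (simp add: inj_on_eq_iff)
        qed
      qed
    qed
    moreover have "strict_prefix (\<iota> u) (\<iota> v)" if uv: "(u, v) \<in> (parcs H)\<^sup>+" for u v
    proof -
      have V: "u \<in> pverts H" "v \<in> pverts H" using trancl_in_verts[OF uv] by auto
      \<comment> \<open>A sink below \<open>v\<close> is also below \<open>u\<close>, so both images
        are initial segments of the same word and only their lengths need comparing.\<close>
      obtain s where s: "s \<in> sinks_below H v" using sinks_below_nonempty[OF V(2)] by blast
      then have "\<iota> u = take (l j u) (X U s)" "\<iota> v = take (l j v) (X U s)"
        using \<Phi>_eq V sinks_below_mono[OF uv] by (auto simp: \<iota>)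
      then have "prefix (\<iota> u) (\<iota> v)"
        using l_mono[OF uv j] by (metis less_imp_le min.absorb1 take_is_prefix take_take)
      moreover have "length (\<iota> u) < length (\<iota> v)"
        using l_mono[OF uv j] l\<Phi>[OF _ P] V \<iota> by simp
      ultimately show ?thesis by (auto intro: strict_prefixI)
    qed
    ultimately show "\<iota> \<in> order_preserving_injections H (complete_binary_tree m)"
      by (simp add: order_preserving_injections_tree)
  qed
  moreover have "inj_on \<Phi> ?P"
  proof (rule inj_onI, clarify)
    fix U j U' j' assume P: "U \<in> ?A0 \<rightarrow>\<^sub>E {u. length u = m - 2 * h}" "j \<in> ?A1 \<rightarrow>\<^sub>E {..<q}"
      "U' \<in> ?A0 \<rightarrow>\<^sub>E {u. length u = m - 2 * h}" "j' \<in> ?A1 \<rightarrow>\<^sub>E {..<q}" and eq: "\<Phi> (U, j) = \<Phi> (U', j')"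
    \<comment> \<open>The image of a sink is its whole word, so \<open>U s\<close> is what follows
      the code.\<close>
    have "U s = U' s" if s: "s \<in> ?A0" for s
    proof -
      have "s \<in> pverts H" using s sinks_subset by blast
      then have "X U s = X U' s"
        using \<Phi>_eq[of s s U j] \<Phi>_eq[of s s U' j'] eq s sinks_below_sink[OF s] lX[OF s] P
        by (simp add: l_def)
      then show ?thesis by (simp add: X_def)
    qed
    then have "U = U'" using P by (intro PiE_ext)
    moreover have "j v = j' v" if v: "v \<in> ?A1" for v
    proof -
      have "v \<in> pverts H" "v \<notin> ?A0" using v by (auto simp: ancestor_verts_eq)
      \<comment> \<open>The depth of the image, less the start of the block, is
        \<open>j v\<close>.\<close>
      moreover from this have "l j v = l j' v" using l\<Phi>[of v U j] l\<Phi>[of v U' j'] eq P by simp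
      ultimately show ?thesis using v by (simp add: l_def)
    qed
    then have "j = j'" using P by (intro PiE_ext)
    ultimately show "U = U' \<and> j = j'" ..
  qed
  moreover have "finite (order_preserving_injections H (complete_binary_tree m))"
    unfolding order_preserving_injections_tree
    by (rule finite_subset[OF _ finite_PiE[OF pair_finite_verts, of "\<lambda>_. {w. length w \<le> m}"]]) (auto simp: finite_bounded_bool_lists)
  ultimately have "card ?P \<le> embedding_count H (complete_binary_tree m)"
    unfolding embedding_count_def by (intro card_inj_on_le)
  then show ?thesis
    using finite_sinks finite_parts
    by (simp add: card_cartesian_product card_PiE card_bool_lists_length_eq q_def)
qed

end

section \<open>From the explicit bounds to the asymptotic statement\<close>

lemma bigtheta_power:
  fixes f g :: "'b \<Rightarrow> 'c :: real_normed_field"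
  shows "f \<in> \<Theta>[F](g) \<Longrightarrow> (\<lambda>x. f x ^ n) \<in> \<Theta>[F](\<lambda>x. g x ^ n)"
  by (auto simp: bigtheta_def landau_o.big_power landau_omega.big_power)

theorem theorem1p8:
  fixes H :: "'a pair_pre_digraph"
  assumes "acyclic_digraph H"
    and "pverts H \<noteq> {}"
  shows "(\<lambda>m. real (embedding_count H (complete_binary_tree m)))
    \<in> \<Theta>(\<lambda>m. let n = real (2 ^ (m + 1) - 1)
          in n ^ card (sinks H) * ln n ^ card (ancestor_verts H))"
proof (rule bigthetaI)
  interpret finite_dag H using assms(1) by unfold_locales
  let ?E = "\<lambda>m. real (embedding_count H (complete_binary_tree m))"
  let ?n = "\<lambda>m. real (2 ^ (m + 1) - 1)"
  \<comment> \<open>The target with \<open>Suc m\<close> in place of \<open>ln n\<close>, which has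
    the same order of growth; both explicit bounds are compared with it.\<close>
  let ?g = "\<lambda>m. ?n m ^ card (sinks H) * real (Suc m) ^ card (ancestor_verts H)"
  have n_eq: "?n m = 2 ^ (m + 1) - 1" for m by (simp add: of_nat_diff)
  have "(\<lambda>m. real (Suc m)) \<in> \<Theta>(\<lambda>m. ln (2 ^ (m + 1) - 1 :: real))"
    by real_asymp
  then have ln: "(\<lambda>m. real (Suc m)) \<in> \<Theta>(\<lambda>m. ln (?n m))"
    unfolding n_eq .
  have g: "?g \<in> \<Theta>(\<lambda>m. let n = ?n m in n ^ card (sinks H) * ln n ^ card (ancestor_verts H))"
    unfolding Let_def by (intro landau_theta.mult bigtheta_refl bigtheta_power ln)
  obtain C where C: "\<And>m. ?E m \<le> C * ?n m ^ card (sinks H) * real (Suc m) ^ card (ancestor_verts H)"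
    by (rule embedding_count_le) blast
  have "?E \<in> O(?g)"
  proof (intro bigoI[of _ C] always_eventually allI)
    fix m
    have "norm (?g m) = ?g m"
      unfolding real_norm_def by (intro abs_of_nonneg mult_nonneg_nonneg zero_le_power of_nat_0_le_iff)
    then show "norm (?E m) \<le> C * norm (?g m)" using C[of m] by (simp only: norm_of_nat mult.assoc)
  qed
  then show "?E \<in> O(\<lambda>m. let n = ?n m in n ^ card (sinks H) * ln n ^ card (ancestor_verts H))"
    using g by (meson bigthetaD1 landau_o.big_trans)
  define h where "h = card (pverts H)"
  \<comment> \<open>Nonemptiness of \<open>H\<close> makes the division by \<open>h\<close>
    meaningful.\<close>
  have h: "0 < h" using assms(2) pair_finite_verts by (simp add: h_def card_gt_0_iff)
  let ?l = "\<lambda>m. real ((2 ^ (m - 2 * h)) ^ card (sinks H) * ((m - 2 * h) div h) ^ card (ancestor_verts H))"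
  have "?g \<in> O(?l)"
  proof -
    have "?n \<in> O(\<lambda>m. 2 ^ (m - 2 * h))"
    proof (intro bigoI[of _ "2 ^ (2 * h + 1)"] eventually_sequentiallyI)
      fix m assume "2 * h \<le> m"
      then have "(2 :: real) ^ (m + 1) = 2 ^ (2 * h + 1) * 2 ^ (m - 2 * h)"
        by (simp flip: power_add)
      moreover have "norm (?n m) \<le> 2 ^ (m + 1)" by (simp only: norm_of_nat) (simp add: n_eq)
      ultimately show "norm (?n m) \<le> 2 ^ (2 * h + 1) * norm (2 ^ (m - 2 * h) :: real)"
        by simp
    qed
    moreover have "(\<lambda>m. real (Suc m)) \<in> O(\<lambda>m. real ((m - 2 * h) div h))"
    proof (intro bigoI[of _ "4 * real h"] eventually_sequentiallyI)
      fix m assume m: "8 * h \<le> m"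
      have "m - 2 * h < h * Suc ((m - 2 * h) div h)"
        using h by (metis div_less_iff_less_mult lessI mult.commute)
      \<comment> \<open>With \<open>d\<close> the quotient, \<open>Suc m\<close> is at most
        \<open>h * d + 3 * h\<close>. The threshold \<open>8 * h\<close> makes \<open>d\<close>
        positive, so \<open>3 * h\<close> is at most \<open>3 * h * d\<close>.\<close>
      then have "Suc m \<le> 4 * h * ((m - 2 * h) div h)"
        using m h by (simp add: algebra_simps)
      then have "real (Suc m) \<le> real (4 * h * ((m - 2 * h) div h))" by (rule of_nat_mono)
      then show "norm (real (Suc m)) \<le> 4 * real h * norm (real ((m - 2 * h) div h))"
        by simp
    qed
    ultimately have "?g \<in> O(\<lambda>m. (2 ^ (m - 2 * h)) ^ card (sinks H) * real ((m - 2 * h) div h) ^ card (ancestor_verts H))"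
      by (intro landau_o.big.mult landau_o.big_power)
    then show ?thesis by simp
  qed
  moreover have "?l \<in> O(?E)"
    using embedding_count_ge
    by (intro bigoI[of _ 1] eventually_sequentiallyI[of "2 * h"]) (simp add: h_def flip: of_nat_mult of_nat_power)
  ultimately show "?E \<in> \<Omega>(\<lambda>m. let n = ?n m in n ^ card (sinks H) * ln n ^ card (ancestor_verts H))"
    using g by (meson bigomega_iff_bigo bigthetaD2 landau_o.big_trans bigtheta_sym bigthetaD1)
qed

end
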